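(* Let $\mathcal S$ be an aperiodic primitive qubit spin substitution in $\mathbb Z^m$ given by $(Q,\mathcal D,G,W)$. There is a unitary matrix $V$, independent of $\vec k$, such that for all $\vec k\in\mathbb R^m$ $$V^{*}B(\vec k)V=\bigoplus_{\chi\in\widehat G}B_\chi(\vec k).$$ Moreover, if $\mathcal S$ is $\chi$-unitary, then $B_\chi(\vec k)=\sqrt{|\det Q|}\,U(\vec k)$ with $U(\vec k)$ unitary, and consequently the Lyapunov exponent of the cocycle generated by $B_\chi$ satisfies $\lambda^{B_\chi}(\vec k)=\log\sqrt{|\det Q|}$ for all $\vec k\in\mathbb R^m$.
   Context: $Q$ is an expansive endomorphism of $\mathbb Z^m$ and $\mathcal D$ a complete set of coset representatives of $\mathbb Z^m/Q\mathbb Z^m$ (so $|\mathcal D|=|\det Q|$). Spin substitution: finite abelian group $G$, $W:\mathcal D\times\mathcal D\to G$, alphabet $\mathcal A=G\times\mathcal D$ with letters $g\mathsf d$, $\mathcal S(g\mathsf d,\vec d')=(gW(\vec d,\vec d'))\mathsf d'$; primitive = substitution matrix has a positive power; aperiodic = no configuration of the (nonempty) generated subshift has a nonzero period. Fourier matrix: the $\mathcal A\times\mathcal A$ matrix $B(\vec k)_{\mathsf a\mathsf b}=\sum_{\vec x\in T_{\mathsf a\mathsf b}}e^{2\pi i\langle\vec k,\vec x\rangle}$ with $T_{\mathsf a\mathsf b}=\{\vec x\in\mathcal D:\mathcal S(\mathsf b,\vec x)=\mathsf a\}$. For $\chi\in\widehat G$, $B_\chi(\vec k)$ is the $\mathcal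 D\times\mathcal D$ matrix with entries $B_\chi(\vec k)_{\vec d,\vec d'}=e^{2\pi i\langle\vec k,\vec d\rangle}\chi(W(\vec d',\vec d))$. For a matrix function $A$, the cocycle is $A^{(n)}(\vec k)=A(\vec k)A(Q^T\vec k)\cdots A((Q^T)^{n-1}\vec k)$ and the (maximal) Lyapunov exponent is $\lambda^A(\vec k)=\limsup_{n\to\infty}\frac1n\log\|A^{(n)}(\vec k)\|$. $\mathcal S$ is $\chi$-unitary if $\frac{1}{\sqrt{|\mathcal D|}}(\chi(W(\vec d,\vec d')))$ is unitary. *)

theory Defs
  imports "HOL-Analysis.Analysis"
begin

section \<open>Integer lattice data\<close>

definition rvec :: "int^'n \<Rightarrow> real^'n" where
  "rvec x = (\<chi> i. real_of_int (x $ i))"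

definition rmat :: "int^'n^'n \<Rightarrow> real^'n^'n" where
  "rmat Q = (\<chi> i j. real_of_int (Q $ i $ j))"

definition cmat :: "int^'n^'n \<Rightarrow> complex^'n^'n" where
  "cmat Q = (\<chi> i j. complex_of_int (Q $ i $ j))"

text \<open>Expansive: every (complex) eigenvalue of Q has modulus greater than 1.\<close>
definition expansive :: "int^'n^'n \<Rightarrow> bool" where
  "expansive Q \<longleftrightarrow>
     (\<forall>(l::complex) (v::complex^'n). v \<noteq> 0 \<and> cmat Q *v v = l *s v \<longrightarrow> 1 < norm l)"

text \<open>D is a complete set of coset representatives of Z^m / Q Z^m.\<close>
definition coset_reps :: "int^'n^'n \<Rightarrow> (int^'n) set \<Rightarrow> bool" where
  "coset_reps Q D \<longleftrightarrow> (\<forall>x. \<exists>!d. d \<in> D \<and> (\<exists>y. x - d = Q *v y))"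

definition digit :: "int^'n^'n \<Rightarrow> (int^'n) set \<Rightarrow> int^'n \<Rightarrow> int^'n" where
  "digit Q D z = (THE d. d \<in> D \<and> (\<exists>y. z - d = Q *v y))"

definition quot :: "int^'n^'n \<Rightarrow> (int^'n) set \<Rightarrow> int^'n \<Rightarrow> int^'n" where
  "quot Q D z = (THE y. z - digit Q D z = Q *v y)"

section \<open>Characters of a finite abelian group\<close>

definition character :: "('g::ab_group_add \<Rightarrow> complex) \<Rightarrow> bool" where
  "character ch \<longleftrightarrow> (\<forall>a b. ch (a + b) = ch a * ch b) \<and> (\<forall>a. norm (ch a) = 1)"

definition dual_group :: "('g::ab_group_add \<Rightarrow> complex) set" where
  "dual_group = {ch. character ch}"

section \<open>Spin substitution\<close>

text \<open>Letters g d are pairs (g, d); the alphabet is G \<times> D.\<close>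
definition alphabet :: "(int^'n) set \<Rightarrow> ('g \<times> (int^'n)) set" where
  "alphabet D = UNIV \<times> D"

definition subst :: "(int^'n \<Rightarrow> int^'n \<Rightarrow> 'g::ab_group_add) \<Rightarrow> 'g \<times> (int^'n) \<Rightarrow> int^'n \<Rightarrow> 'g \<times> (int^'n)" where
  "subst W a d' = (fst a + W (snd a) d', d')"

section \<open>Matrices indexed by finite sets (as functions)\<close>

definition mmul :: "'j set \<Rightarrow> ('i \<Rightarrow> 'j \<Rightarrow> 'a::comm_semiring_1) \<Rightarrow> ('j \<Rightarrow> 'k \<Rightarrow> 'a) \<Rightarrow> 'i \<Rightarrow> 'k \<Rightarrow> 'a" where
  "mmul J A B i k = (\<Sum>j\<in>J. A i j * B j k)"

definition idm :: "'i \<Rightarrow> 'i \<Rightarrow> 'a::comm_semiring_1" where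
  "idm i j = (if i = j then 1 else 0)"

primrec mpow :: "'i set \<Rightarrow> ('i \<Rightarrow> 'i \<Rightarrow> 'a::comm_semiring_1) \<Rightarrow> nat \<Rightarrow> 'i \<Rightarrow> 'i \<Rightarrow> 'a" where
  "mpow I M 0 = idm"
| "mpow I M (Suc n) = mmul I M (mpow I M n)"

definition adj :: "('i \<Rightarrow> 'j \<Rightarrow> complex) \<Rightarrow> 'j \<Rightarrow> 'i \<Rightarrow> complex" where
  "adj V j i = cnj (V i j)"

text \<open>V with rows indexed by R and columns indexed by C is unitary.\<close>
definition unitary_on :: "'i set \<Rightarrow> 'j set \<Rightarrow> ('i \<Rightarrow> 'j \<Rightarrow> complex) \<Rightarrow> bool" where
  "unitary_on R C V \<longleftrightarrow> finite R \<and> finite C \<and>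
     (\<forall>c\<in>C. \<forall>c'\<in>C. mmul R (adj V) V c c' = idm c c') \<and>
     (\<forall>r\<in>R. \<forall>r'\<in>R. mmul C V (adj V) r r' = idm r r')"

text \<open>Block diagonal (direct sum) of a family of D\<times>D matrices indexed by characters.\<close>
definition block_diag :: "('c \<Rightarrow> 'i \<Rightarrow> 'i \<Rightarrow> complex) \<Rightarrow> 'c \<times> 'i \<Rightarrow> 'c \<times> 'i \<Rightarrow> complex" where
  "block_diag Bs x y = (if fst x = fst y then Bs (fst x) (snd x) (snd y) else 0)"

section \<open>Substitution matrix, primitivity, subshift, aperiodicity\<close>

definition subst_matrix :: "(int^'n) set \<Rightarrow> (int^'n \<Rightarrow> int^'n \<Rightarrow> 'g::ab_group_add)
    \<Rightarrow> 'g \<times> (int^'n) \<Rightarrow> 'g \<times> (int^'n) \<Rightarrow> nat" where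
  "subst_matrix D W a b = card {x \<in> D. subst W b x = a}"

definition primitive :: "(int^'n) set \<Rightarrow> (int^'n \<Rightarrow> int^'n \<Rightarrow> 'g::ab_group_add) \<Rightarrow> bool" where
  "primitive D W \<longleftrightarrow> (\<exists>n>0. \<forall>a\<in>alphabet D. \<forall>b\<in>alphabet D.
       0 < mpow (alphabet D) (subst_matrix D W) n a b)"

text \<open>n-th iterate of the substitution applied to a single letter placed at the origin,
  as a partial patch: S(P)(Q x + d) = S(P(x), d).\<close>
primrec subst_pow :: "int^'n^'n \<Rightarrow> (int^'n) set \<Rightarrow> (int^'n \<Rightarrow> int^'n \<Rightarrow> 'g::ab_group_add)
    \<Rightarrow> nat \<Rightarrow> 'g \<times> (int^'n) \<Rightarrow> int^'n \<Rightarrow> ('g \<times> (int^'n)) option" where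
  "subst_pow Q D W 0 a = (\<lambda>z. if z = 0 then Some a else None)"
| "subst_pow Q D W (Suc n) a = (\<lambda>z. case subst_pow Q D W n a (quot Q D z) of
       None \<Rightarrow> None | Some b \<Rightarrow> Some (subst W b (digit Q D z)))"

text \<open>The subshift generated by S: configurations all of whose finite patches are legal.\<close>
definition subshift :: "int^'n^'n \<Rightarrow> (int^'n) set \<Rightarrow> (int^'n \<Rightarrow> int^'n \<Rightarrow> 'g::ab_group_add)
    \<Rightarrow> (int^'n \<Rightarrow> 'g \<times> (int^'n)) set" where
  "subshift Q D W = {c. (\<forall>z. c z \<in> alphabet D) \<and>
     (\<forall>F. finite F \<longrightarrow> (\<exists>n a t. a \<in> alphabet D \<and>
         (\<forall>z\<in>F. subst_pow Q D W n a (z + t) = Some (c z))))}"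

definition aperiodic :: "int^'n^'n \<Rightarrow> (int^'n) set \<Rightarrow> (int^'n \<Rightarrow> int^'n \<Rightarrow> 'g::ab_group_add) \<Rightarrow> bool" where
  "aperiodic Q D W \<longleftrightarrow> subshift Q D W \<noteq> {} \<and>
     (\<forall>c\<in>subshift Q D W. \<forall>p. p \<noteq> 0 \<longrightarrow> \<not> (\<forall>z. c (z + p) = c z))"

section \<open>Fourier matrices\<close>

definition fourier_matrix :: "(int^'n) set \<Rightarrow> (int^'n \<Rightarrow> int^'n \<Rightarrow> 'g::ab_group_add) \<Rightarrow> real^'n
    \<Rightarrow> 'g \<times> (int^'n) \<Rightarrow> 'g \<times> (int^'n) \<Rightarrow> complex" where
  "fourier_matrix D W k a b =
     (\<Sum>x\<in>{x \<in> D. subst W b x = a}. exp (2 * of_real pi * \<i> * of_real (k \<bullet> rvec x)))"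

definition B_chi :: "(int^'n \<Rightarrow> int^'n \<Rightarrow> 'g) \<Rightarrow> ('g \<Rightarrow> complex) \<Rightarrow> real^'n
    \<Rightarrow> int^'n \<Rightarrow> int^'n \<Rightarrow> complex" where
  "B_chi W ch k d d' = exp (2 * of_real pi * \<i> * of_real (k \<bullet> rvec d)) * ch (W d' d)"

definition chi_unitary :: "(int^'n) set \<Rightarrow> (int^'n \<Rightarrow> int^'n \<Rightarrow> 'g) \<Rightarrow> ('g \<Rightarrow> complex) \<Rightarrow> bool" where
  "chi_unitary D W ch \<longleftrightarrow>
     unitary_on D D (\<lambda>d d'. ch (W d d') / of_real (sqrt (real (card D))))"

section \<open>Cocycles and Lyapunov exponents\<close>

text \<open>A^(n)(k) = A(k) A(T k) ... A(T^(n-1) k), with T = Q^T.\<close>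
primrec cocycle :: "(real^'n \<Rightarrow> 'i \<Rightarrow> 'i \<Rightarrow> complex) \<Rightarrow> real^'n^'n \<Rightarrow> 'i set \<Rightarrow> nat
    \<Rightarrow> real^'n \<Rightarrow> 'i \<Rightarrow> 'i \<Rightarrow> complex" where
  "cocycle A T I 0 k = idm"
| "cocycle A T I (Suc n) k = mmul I (A k) (cocycle A T I n (T *v k))"

text \<open>Operator norm induced by the Euclidean norm on C^I.\<close>
definition opnorm :: "'i set \<Rightarrow> ('i \<Rightarrow> 'i \<Rightarrow> complex) \<Rightarrow> real" where
  "opnorm I M = Sup {sqrt (\<Sum>i\<in>I. (cmod (\<Sum>j\<in>I. M i j * v j))\<^sup>2) | v.
                       (\<Sum>j\<in>I. (cmod (v j))\<^sup>2) \<le> 1}"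

definition lyapunov :: "(real^'n \<Rightarrow> 'i \<Rightarrow> 'i \<Rightarrow> complex) \<Rightarrow> real^'n^'n \<Rightarrow> 'i set \<Rightarrow> real^'n \<Rightarrow> ereal" where
  "lyapunov A T I k = limsup (\<lambda>n. ereal (ln (opnorm I (cocycle A T I n k)) / real n))"

end

theory Submission
  imports Defs
begin

text \<open>The Fourier matrix maps a letter \<open>g'd'\<close> to letters \<open>(g' + W(d', d)) d\<close>, i.e. on the
  group coordinate it acts by translations. Conjugating with the unitary whose columns are the
  normalised characters of \<open>G\<close>, placed on the fibres \<open>G \<times> {d}\<close>, therefore splits it into one
  \<open>D \<times> D\<close> block per character; for a qubit group every element is its own inverse, and the
  blocks are exactly the \<open>B\<^sub>\<chi>\<close>. If \<open>\<chi>(W)/\<surd>|D|\<close> is unitary, each \<open>B\<^sub>\<chi>(k)\<close> is \<open>\<surd>|D|\<close> times a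
  unitary, so the \<open>n\<close>-th cocycle is \<open>\<surd>|D|\<^sup>n\<close> times a unitary and its norm is exactly \<open>\<surd>|D|\<^sup>n\<close>.
  Finally \<open>|D| = [\<int>\<^sup>m : Q\<int>\<^sup>m] = |det Q|\<close>, by comparing volumes of fundamental domains.\<close>

section \<open>Lebesgue measure of linear images\<close>

lemma measure_swap_coordinates_cbox:
  fixes a b :: "real^'n"
  shows "measure lebesgue ((\<lambda>x. \<chi> i. x $ Transposition.transpose m n i) ` cbox a b)
           = measure lebesgue (cbox a b)"
proof (cases "cbox a b = {}")
  case False
  let ?swap = "\<lambda>x::real^'n. \<chi> i. x $ Transposition.transpose m n i"
  have image: "?swap ` cbox a b = cbox (?swap a) (?swap b)"
    by (auto simp: image_iff lambda_swap_Galois mem_box_cart) (metis transpose_involutory)+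
  then have "cbox (?swap a) (?swap b) \<noteq> {}"
    using False by blast
  moreover have "(\<Prod>i\<in>UNIV. b $ Transposition.transpose m n i - a $ Transposition.transpose m n i)
                 = (\<Prod>i\<in>UNIV. b $ i - a $ i)"
    using prod.permute [OF permutes_swap_id, where S=UNIV and g="\<lambda>i. b $ i - a $ i"]
    by (simp add: o_def)
  ultimately show ?thesis
    using False by (simp add: image content_cbox_cart)
qed simp

lemma measure_shear_cbox:
  fixes a b :: "real^'n"
  assumes "m \<noteq> n"
  shows "measure lebesgue ((\<lambda>x. \<chi> i. if i = m then x $ m + x $ n else x $ i) ` cbox a b)
           = measure lebesgue (cbox a b)"
proof (cases "cbox a b = {}")
  case False
  define shear where "shear = (\<lambda>x::real^'n. \<chi> i. if i = m then x $ m + x $ n else x $ i)"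
  \<comment> \<open>\<open>measure_shear_interval\<close> needs \<open>0 \<le> a $ n\<close>, so the box is first moved by \<open>v\<close>\<close>
  define v :: "real^'n" where "v = (\<chi> i. if i = n then - a $ n else 0)"
  have "linear shear"
    unfolding shear_def by (rule linearI) (auto simp: vec_eq_iff algebra_simps)
  then have "shear ` cbox a b = (+) (shear (- v)) ` shear ` (+) v ` cbox a b"
    by (simp add: image_comp o_def linear_add linear_neg)
  then have "measure lebesgue (shear ` cbox a b) = measure lebesgue (shear ` cbox (v + a) (v + b))"
    by (simp add: cbox_translation measure_translation)
  also have "\<dots> = measure lebesgue (cbox (v + a) (v + b))"
  proof -
    have "cbox (v + a) (v + b) \<noteq> {}"
      using False by (metis cbox_translation image_is_empty)
    then show ?thesis
      using \<open>m \<noteq> n\<close> unfolding shear_def by (intro measure_shear_interval) (auto simp: v_def)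
  qed
  also have "\<dots> = measure lebesgue (cbox a b)"
    by (metis cbox_translation measure_translation)
  finally show ?thesis
    by (simp add: shear_def)
qed simp

lemma det_swap_coordinates:
  assumes "m \<noteq> n"
  shows "\<bar>det (matrix (\<lambda>x::real^'n. \<chi> i. x $ Transposition.transpose m n i))\<bar> = 1"
proof -
  have "matrix (\<lambda>x::real^'n. \<chi> i. x $ Transposition.transpose m n i)
          = transpose (\<chi> i j. mat 1 $ i $ Transposition.transpose m n j)"
    by (auto simp: matrix_eq transpose_def axis_def mat_def matrix_def eq_commute[of _ "Transposition.transpose m n _"])
  then show ?thesis
    by (simp add: det_permute_columns permutes_swap_id sign_swap_id abs_mult)
qed

lemma det_shear:
  assumes "m \<noteq> n"
  shows "det (matrix (\<lambda>x::real^'n. \<chi> i. if i = m then x $ m + x $ n else x $ i)) = 1"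
proof -
  have "matrix (\<lambda>x::real^'n. \<chi> i. if i = m then x $ m + x $ n else x $ i)
          = (\<chi> k. if k = m then row m (mat 1) + 1 *s row n (mat 1) else row k (mat 1))"
    by (auto simp: matrix_def vec_eq_iff row_def mat_def axis_def)
  then show ?thesis
    using det_row_operation[OF assms, of "mat 1 :: real^'n^'n" 1] by simp
qed

text \<open>The library states this (as \<open>measure_linear_image\<close>) only for well-ordered index
  types; the proof by elementary matrices needs no order on the index type.\<close>
lemma measure_linear_image_cart:
  fixes f :: "real^'n \<Rightarrow> real^'n"
  assumes "linear f" and "S \<in> lmeasurable"
  shows "f ` S \<in> lmeasurable \<and> measure lebesgue (f ` S) = \<bar>det (matrix f)\<bar> * measure lebesgue S"
proof -
  define P where "P g \<longleftrightarrow> (\<forall>S \<in> lmeasurable. g ` S \<in> lmeasurable \<and>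
    measure lebesgue (g ` S) = \<bar>det (matrix g)\<bar> * measure lebesgue S)" for g :: "real^'n \<Rightarrow> real^'n"
  have on_boxes: "P g" if "linear g"
    and "\<And>a b. measure lebesgue (g ` cbox a b) = \<bar>det (matrix g)\<bar> * measure lebesgue (cbox a b)" for g
    using measure_linear_sufficient[OF that(1)] that(2) unfolding P_def by metis
  have "P f"
  proof (rule induct_linear_elementary[OF \<open>linear f\<close>])
    fix g h :: "real^'n \<Rightarrow> real^'n"
    assume "linear g" "linear h" "P g" "P h"
    then show "P (g \<circ> h)"
      unfolding P_def image_comp [symmetric] matrix_compose [OF \<open>linear h\<close> \<open>linear g\<close>]
      by (simp add: det_mul abs_mult)
  next
    fix g :: "real^'n \<Rightarrow> real^'n" and i
    assume "linear g" and "\<And>x. g x $ i = 0"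
    then have "\<not> inj g"
      by (metis linear_injective_imp_surjective one_neq_zero surjE vec_component)
    then have "det (matrix g) = 0" and "measure lebesgue (g ` T) = 0" for T
      using \<open>linear g\<close> det_nz_iff_inj negligible_imp_measure0 negligible_linear_singular_image
      by blast+
    then show "P g"
      using \<open>linear g\<close> by (intro on_boxes) auto
  next
    fix c :: "'n \<Rightarrow> real"
    show "P (\<lambda>x. \<chi> i. c i * x $ i)"
      unfolding P_def
      by (simp add: measurable_stretch measure_stretch axis_def matrix_def det_diagonal)
  next
    fix m n :: 'n
    assume "m \<noteq> n"
    have "linear (\<lambda>x::real^'n. \<chi> i. x $ Transposition.transpose m n i)"
      by (rule linearI) (simp_all add: vec_eq_iff)
    then show "P (\<lambda>x. \<chi> i. x $ Transposition.transpose m n i)"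
      by (rule on_boxes) (simp add: measure_swap_coordinates_cbox det_swap_coordinates[OF \<open>m \<noteq> n\<close>])
  next
    fix m n :: 'n
    assume "m \<noteq> n"
    have "linear (\<lambda>x::real^'n. \<chi> i. if i = m then x $ m + x $ n else x $ i)"
      by (rule linearI) (auto simp: vec_eq_iff algebra_simps)
    then show "P (\<lambda>x. \<chi> i. if i = m then x $ m + x $ n else x $ i)"
      by (rule on_boxes) (simp add: measure_shear_cbox det_shear \<open>m \<noteq> n\<close>)
  qed
  then show ?thesis
    using assms(2) unfolding P_def by blast
qed

section \<open>Fundamental domains of the integer lattice\<close>

lemma rvec_minus: "rvec (- a) = - rvec a"
  by (simp add: rvec_def vec_eq_iff)

lemma rvec_eq_iff: "rvec a = rvec b \<longleftrightarrow> a = b"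
  by (simp add: rvec_def vec_eq_iff)

lemma rvec_matrix_vector_mult: "rvec (Q *v y) = rmat Q *v rvec y"
  by (simp add: rvec_def rmat_def vec_eq_iff matrix_vector_mult_def)

definition floor_vec :: "real^'n \<Rightarrow> int^'n" where
  "floor_vec x = (\<chi> i. \<lfloor>x $ i\<rfloor>)"

definition unit_cube :: "(real^'n) set" where
  "unit_cube = {x. \<forall>i. 0 \<le> x $ i \<and> x $ i < 1}"

definition fundamental_domain :: "(real^'n) set \<Rightarrow> bool" where
  "fundamental_domain F \<longleftrightarrow> (\<forall>x. \<exists>!z. x - rvec z \<in> F)"

lemma
  assumes "fundamental_domain F"
  shows fundamental_domain_ex: "\<exists>z. x - rvec z \<in> F"
    and fundamental_domain_unique: "x - rvec z \<in> F \<Longrightarrow> x - rvec w \<in> F \<Longrightarrow> z = w"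
  using assms unfolding fundamental_domain_def by blast+

lemma floor_vec_diff_rvec: "floor_vec (x - rvec z) = floor_vec x - z"
  by (simp add: floor_vec_def rvec_def vec_eq_iff)

lemma diff_rvec_in_unit_cube_iff: "x - rvec z \<in> unit_cube \<longleftrightarrow> z = floor_vec x"
proof -
  have "0 \<le> a - of_int k \<and> a - of_int k < 1 \<longleftrightarrow> k = \<lfloor>a\<rfloor>" for a :: real and k
    by (metis add.commute diff_ge_0_iff_ge diff_less_eq floor_unique of_int_floor_le
        real_of_int_floor_add_one_gt)
  then show ?thesis
    by (simp add: unit_cube_def floor_vec_def rvec_def vec_eq_iff)
qed

lemma fundamental_domain_unit_cube: "fundamental_domain unit_cube"
  by (simp add: fundamental_domain_def diff_rvec_in_unit_cube_iff)

lemma unit_cube_between_boxes: "box 0 1 \<subseteq> unit_cube" "unit_cube \<subseteq> cbox 0 (1::real^'n)"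
  by (auto simp: unit_cube_def mem_box_cart less_imp_le)

lemma bounded_unit_cube: "bounded (unit_cube :: (real^'n) set)"
  using unit_cube_between_boxes(2) bounded_cbox bounded_subset by blast

lemma lmeasurable_unit_cube: "(unit_cube :: (real^'n) set) \<in> lmeasurable"
  and measure_unit_cube: "measure lebesgue (unit_cube :: (real^'n) set) = 1"
proof -
  have neg: "negligible (cbox 0 1 - unit_cube \<union> (unit_cube - cbox 0 (1::real^'n)))"
    using unit_cube_between_boxes by (blast intro: negligible_subset[OF negligible_frontier_interval])
  show "(unit_cube :: (real^'n) set) \<in> lmeasurable"
    using lmeasurable_negligible_symdiff[OF lmeasurable_cbox neg] .
  have "(0::real^'n) \<in> cbox 0 1"
    by (simp add: mem_box_cart)
  then have "cbox 0 (1::real^'n) \<noteq> {}"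
    by blast
  then have "measure lebesgue (cbox 0 (1::real^'n)) = 1"
    by (simp add: content_cbox_cart)
  then show "measure lebesgue (unit_cube :: (real^'n) set) = 1"
    using measure_negligible_symdiff[OF lmeasurable_cbox neg] by simp
qed

lemma finite_lattice_points_in_bounded:
  assumes "bounded B"
  shows "finite {z::int^'n. rvec z \<in> B}"
proof -
  obtain R where R: "\<And>x. x \<in> B \<Longrightarrow> norm x \<le> R"
    using assms bounded_iff by blast
  have "{z. rvec z \<in> B} \<subseteq> vec_lambda ` (UNIV \<rightarrow>\<^sub>E {-\<lceil>R\<rceil>..\<lceil>R\<rceil>})"
  proof
    fix z :: "int^'n"
    assume "z \<in> {z. rvec z \<in> B}"
    then have "\<bar>rvec z $ i\<bar> \<le> R" for i
      using order.trans[OF component_le_norm_cart R] by blast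
    then have "\<bar>real_of_int (z $ i)\<bar> \<le> R" for i
      by (simp add: rvec_def)
    then have "\<bar>z $ i\<bar> \<le> \<lceil>R\<rceil>" for i
      by (metis ceiling_mono ceiling_of_int of_int_abs)
    then have "vec_nth z \<in> UNIV \<rightarrow>\<^sub>E {-\<lceil>R\<rceil>..\<lceil>R\<rceil>}"
      by (simp add: PiE_iff abs_le_iff minus_le_iff)
    then show "z \<in> vec_lambda ` (UNIV \<rightarrow>\<^sub>E {-\<lceil>R\<rceil>..\<lceil>R\<rceil>})"
      by (metis image_eqI vec_lambda_eta)
  qed
  then show ?thesis
    by (rule finite_subset) (intro finite_imageI finite_PiE; simp)
qed

lemma measure_split_by_lattice_translates:
  assumes "F \<in> lmeasurable" and "G \<in> lmeasurable" and "fundamental_domain G" and "finite Z"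
    and "\<And>x z. x \<in> F \<Longrightarrow> x - rvec z \<in> G \<Longrightarrow> z \<in> Z"
  shows "measure lebesgue F = (\<Sum>z\<in>Z. measure lebesgue {x \<in> F. x - rvec z \<in> G})"
proof -
  define A where "A z = {x \<in> F. x - rvec z \<in> G}" for z
  have "A z = F \<inter> (+) (rvec z) ` G" for z
    by (force simp: A_def)
  then have "A z \<in> lmeasurable" for z
    using assms(1,2) by (simp add: fmeasurable_Int_fmeasurable fmeasurableD measurable_translation)
  moreover have "F = (\<Union>z\<in>Z. A z)"
  proof
    show "F \<subseteq> (\<Union>z\<in>Z. A z)"
    proof
      fix x
      assume "x \<in> F"
      obtain z where "x - rvec z \<in> G"
        using fundamental_domain_ex[OF assms(3)] by blast
      then show "x \<in> (\<Union>z\<in>Z. A z)"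
        using assms(5) \<open>x \<in> F\<close> by (auto simp: A_def)
    qed
  qed (auto simp: A_def)
  moreover have "pairwise (\<lambda>z w. negligible (A z \<inter> A w)) Z"
  proof -
    have "A z \<inter> A w = {}" if "z \<noteq> w" for z w
      using fundamental_domain_unique[OF assms(3)] that unfolding A_def by blast
    then show ?thesis
      by (simp add: pairwise_def)
  qed
  ultimately have "measure lebesgue F = (\<Sum>z\<in>Z. measure lebesgue (A z))"
    using \<open>finite Z\<close> by (simp add: measure_negligible_finite_Union_image)
  then show ?thesis
    by (simp add: A_def)
qed

text \<open>Both sides are cut into the pieces \<open>F \<inter> (z + G)\<close> and \<open>(F - z) \<inter> G\<close>, which are
  translates of each other.\<close>
lemma measure_fundamental_domains_eq:
  fixes F G :: "(real^'n) set"
  assumes F: "F \<in> lmeasurable" "bounded F" "fundamental_domain F"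
    and G: "G \<in> lmeasurable" "bounded G" "fundamental_domain G"
  shows "measure lebesgue F = measure lebesgue G"
proof -
  define Z where "Z = {z. rvec z \<in> {x - y | x y. x \<in> F \<and> y \<in> G}}"
  have "bounded {x - y | x y. x \<in> F \<and> y \<in> G}"
    using bounded_minus[OF F(2) G(2)] by (rule bounded_subset) auto
  then have "finite Z"
    unfolding Z_def by (rule finite_lattice_points_in_bounded)
  have "z \<in> Z" if "x \<in> F" "x - rvec z \<in> G" for x z
  proof -
    have "rvec z = x - (x - rvec z)"
      by simp
    then show ?thesis
      using that unfolding Z_def by blast
  qed
  then have "measure lebesgue F = (\<Sum>z\<in>Z. measure lebesgue {x \<in> F. x - rvec z \<in> G})"
    by (rule measure_split_by_lattice_translates[OF F(1) G(1,3) \<open>finite Z\<close>])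
  also have "\<dots> = (\<Sum>z\<in>Z. measure lebesgue {y \<in> G. y - rvec (- z) \<in> F})"
  proof (intro sum.cong refl)
    fix z
    have "(\<lambda>x. x - rvec z) ` {x \<in> F. x - rvec z \<in> G} = {y \<in> G. y - rvec (- z) \<in> F}"
      by (auto simp: rvec_minus image_iff) (metis add_diff_cancel_right')
    then show "measure lebesgue {x \<in> F. x - rvec z \<in> G} = measure lebesgue {y \<in> G. y - rvec (- z) \<in> F}"
      using measure_translation_subtract[of "rvec z" "{x \<in> F. x - rvec z \<in> G}"] by simp
  qed
  also have "\<dots> = (\<Sum>z\<in>uminus ` Z. measure lebesgue {y \<in> G. y - rvec z \<in> F})"
    by (rule sum.reindex[OF inj_uminus, symmetric, unfolded o_def])
  also have "\<dots> = measure lebesgue G"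
  proof (rule measure_split_by_lattice_translates[symmetric])
    show "z \<in> uminus ` Z" if "y \<in> G" "y - rvec z \<in> F" for y z
    proof -
      have "rvec (- z) = (y - rvec z) - y"
        by (simp add: rvec_minus)
      then have "- z \<in> Z"
        using that unfolding Z_def by blast
      then show ?thesis
        by (rule image_eqI[rotated]) simp
    qed
  qed (use G(1) F(1,3) \<open>finite Z\<close> in simp_all)
  finally show ?thesis .
qed

corollary measure_fundamental_domain:
  assumes "F \<in> lmeasurable" "bounded F" "fundamental_domain F"
  shows "measure lebesgue F = 1"
  using measure_fundamental_domains_eq[OF assms lmeasurable_unit_cube bounded_unit_cube
      fundamental_domain_unit_cube] by (simp add: measure_unit_cube)

lemma inj_matrix_vector_mult_int:
  fixes Q :: "int^'n^'n"
  assumes "det (rmat Q) \<noteq> 0"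
  shows "inj ((*v) Q)"
proof (rule injI)
  fix y y' :: "int^'n"
  assume "Q *v y = Q *v y'"
  then have "rmat Q *v rvec y = rmat Q *v rvec y'"
    by (simp flip: rvec_matrix_vector_mult)
  then show "y = y'"
    using assms det_nz_iff_inj[OF matrix_vector_mul_linear] by (metis matrix_of_matrix_vector_mul injD rvec_eq_iff)
qed

lemma coset_reps_ex1_quotient:
  assumes "coset_reps Q D" and "inj ((*v) Q)"
  shows "\<exists>!y. w - Q *v y \<in> D"
proof -
  obtain d where "d \<in> D" "\<exists>y. w - d = Q *v y"
    and unique: "\<And>d'. d' \<in> D \<Longrightarrow> \<exists>y. w - d' = Q *v y \<Longrightarrow> d' = d"
    using assms(1) unfolding coset_reps_def by blast
  then obtain y where "w - d = Q *v y"
    by blast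
  then have "w = d + Q *v y"
    by (simp add: diff_eq_eq add.commute)
  have "y' = y" if "w - Q *v y' \<in> D" for y'
  proof -
    have "\<exists>z. w - (w - Q *v y') = Q *v z"
      by auto
    then have "w - Q *v y' = d"
      using unique[OF that] by blast
    then have "Q *v y' = Q *v y"
      using \<open>w = d + Q *v y\<close> by simp
    then show ?thesis
      using injD[OF assms(2)] by blast
  qed
  moreover have "w - Q *v y \<in> D"
    using \<open>d \<in> D\<close> \<open>w = d + Q *v y\<close> by simp
  ultimately show ?thesis
    by blast
qed

lemma mem_translated_unit_cube_iff: "x \<in> (+) (rvec d) ` unit_cube \<longleftrightarrow> d = floor_vec x"
proof -
  have "x \<in> (+) (rvec d) ` unit_cube \<longleftrightarrow> x - rvec d \<in> unit_cube"
  proof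
    assume "x - rvec d \<in> unit_cube"
    then have "rvec d + (x - rvec d) \<in> (+) (rvec d) ` unit_cube"
      by blast
    then show "x \<in> (+) (rvec d) ` unit_cube"
      by simp
  qed auto
  then show ?thesis
    by (simp add: diff_rvec_in_unit_cube_iff)
qed

lemma floor_vec_preimage_eq_UN_cubes: "{x. floor_vec x \<in> D} = (\<Union>d\<in>D. (+) (rvec d) ` unit_cube)"
  by (simp only: set_eq_iff UN_iff mem_translated_unit_cube_iff mem_Collect_eq) blast

lemma floor_vec_preimage_finite:
  assumes "finite D"
  shows "{x. floor_vec x \<in> D} \<in> lmeasurable" and "bounded {x. floor_vec x \<in> D}"
    and "measure lebesgue {x. floor_vec x \<in> D} = real (card D)"
proof -
  have cube: "(+) (rvec d) ` unit_cube \<in> lmeasurable" "bounded ((+) (rvec d) ` unit_cube)" for d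
    by (simp_all add: lmeasurable_unit_cube measurable_translation bounded_unit_cube bounded_translation)
  then show "{x. floor_vec x \<in> D} \<in> lmeasurable" and "bounded {x. floor_vec x \<in> D}"
    using assms unfolding floor_vec_preimage_eq_UN_cubes by auto
  have "(+) (rvec d) ` unit_cube \<inter> (+) (rvec e) ` unit_cube = {}" if "d \<noteq> e" for d e
    using that by (simp only: disjoint_iff mem_translated_unit_cube_iff) auto
  then have "pairwise (\<lambda>d e. negligible ((+) (rvec d) ` unit_cube \<inter> (+) (rvec e) ` unit_cube)) D"
    unfolding pairwise_def by (metis negligible_empty)
  then have "measure lebesgue {x. floor_vec x \<in> D} = (\<Sum>d\<in>D. measure lebesgue ((+) (rvec d) ` unit_cube))"
    unfolding floor_vec_preimage_eq_UN_cubes using assms cube(1)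
    by (intro measure_negligible_finite_Union_image)
  also have "\<dots> = real (card D)"
    by (simp add: measure_translation measure_unit_cube)
  finally show "measure lebesgue {x. floor_vec x \<in> D} = real (card D)" .
qed

lemma fundamental_domain_floor_vec_preimage:
  assumes "coset_reps Q D" and "det (rmat Q) \<noteq> 0"
  shows "fundamental_domain {x. floor_vec (rmat Q *v x) \<in> D}"
  unfolding fundamental_domain_def
proof
  fix x
  have "floor_vec (rmat Q *v (x - rvec y)) = floor_vec (rmat Q *v x) - Q *v y" for y
    by (simp add: matrix_vector_mult_diff_distrib floor_vec_diff_rvec flip: rvec_matrix_vector_mult)
  then show "\<exists>!y. x - rvec y \<in> {x. floor_vec (rmat Q *v x) \<in> D}"
    using coset_reps_ex1_quotient[OF assms(1) inj_matrix_vector_mult_int[OF assms(2)]] by simp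
qed

text \<open>The unit cubes at the digits have total volume \<open>card D\<close>, and their preimage under \<open>Q\<close>
  is a fundamental domain of \<open>\<int>\<^sup>m\<close> because the translates of \<open>D\<close> by \<open>Q\<int>\<^sup>m\<close> tile \<open>\<int>\<^sup>m\<close>.\<close>
theorem card_coset_reps_eq_abs_det:
  fixes Q :: "int^'n^'n"
  assumes "coset_reps Q D" and "finite D" and "det (rmat Q) \<noteq> 0"
  shows "real (card D) = \<bar>det (rmat Q)\<bar>"
proof -
  define E where "E = {x. floor_vec x \<in> D}"
  obtain T' where "rmat Q ** T' = mat 1" "T' ** rmat Q = mat 1"
    using assms(3) invertible_det_nz unfolding invertible_def by blast
  then have F_eq: "{x. floor_vec (rmat Q *v x) \<in> D} = (*v) T' ` E"
    by (force simp: E_def matrix_vector_mul_assoc)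
  have "E \<in> lmeasurable" "bounded E" "measure lebesgue E = real (card D)"
    unfolding E_def using floor_vec_preimage_finite[OF assms(2)] by auto
  then have "(*v) T' ` E \<in> lmeasurable" "bounded ((*v) T' ` E)"
    using measure_linear_image_cart[OF matrix_vector_mul_linear] by (auto simp: bounded_linear_image)
  then have "measure lebesgue ((*v) T' ` E) = 1"
    using fundamental_domain_floor_vec_preimage[OF assms(1,3)] measure_fundamental_domain
    unfolding F_eq by blast
  moreover have "(*v) (rmat Q) ` (*v) T' ` E = E"
    using \<open>rmat Q ** T' = mat 1\<close> by (simp add: image_comp o_def matrix_vector_mul_assoc)
  ultimately show ?thesis
    using measure_linear_image_cart[OF matrix_vector_mul_linear \<open>(*v) T' ` E \<in> lmeasurable\<close>, of "rmat Q"]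
      \<open>measure lebesgue E = real (card D)\<close> by simp
qed

lemma expansive_det_nonzero:
  fixes Q :: "int^'n^'n"
  assumes "expansive Q"
  shows "det (rmat Q) \<noteq> 0"
proof
  assume "det (rmat Q) = 0"
  then obtain v where "v \<noteq> 0" "rmat Q *v v = 0"
    using det_nz_iff_inj[OF matrix_vector_mul_linear] linear_injective_0[OF matrix_vector_mul_linear]
    by (metis matrix_of_matrix_vector_mul)
  define w :: "complex^'n" where "w = (\<chi> i. complex_of_real (v $ i))"
  have "w \<noteq> 0"
    using \<open>v \<noteq> 0\<close> by (simp add: w_def vec_eq_iff)
  moreover have "cmat Q *v w = 0 *s w"
  proof -
    have "(cmat Q *v w) $ i = complex_of_real ((rmat Q *v v) $ i)" for i
      by (simp add: cmat_def rmat_def w_def matrix_vector_mult_def)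
    then show ?thesis
      using \<open>rmat Q *v v = 0\<close> by (simp add: vec_eq_iff)
  qed
  ultimately show False
    using assms unfolding expansive_def by fastforce
qed

lemma coset_reps_nonempty: "coset_reps Q D \<Longrightarrow> D \<noteq> {}"
  unfolding coset_reps_def by blast

text \<open>Over an infinite index set every \<open>mmul\<close>-entry is the junk value \<open>0\<close> of an infinite
  sum, so primitivity forces \<open>D\<close> to be finite.\<close>
lemma primitive_imp_finite:
  fixes W :: "int^'n \<Rightarrow> int^'n \<Rightarrow> 'g::ab_group_add"
  assumes "primitive D W" and "D \<noteq> {}"
  shows "finite D"
proof (rule ccontr)
  assume "infinite D"
  then have "infinite (alphabet D :: ('g \<times> (int^'n)) set)"
    unfolding alphabet_def using finite_cartesian_productD2 by blast
  obtain n where "n > 0"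
    and pos: "\<forall>a\<in>alphabet D. \<forall>b\<in>alphabet D. 0 < mpow (alphabet D) (subst_matrix D W) n a b"
    using assms(1) unfolding primitive_def by blast
  obtain d where "d \<in> D"
    using assms(2) by blast
  then have "(0, d) \<in> alphabet D"
    by (simp add: alphabet_def)
  moreover have "mpow (alphabet D) (subst_matrix D W) n (0, d) (0, d) = 0"
    using \<open>infinite (alphabet D)\<close> \<open>n > 0\<close> by (cases n) (simp_all add: mmul_def)
  ultimately show False
    using pos by fastforce
qed

section \<open>Block decomposition of the Fourier matrix\<close>

lemma character_zero: "character ch \<Longrightarrow> ch 0 = 1"
  unfolding character_def by (metis add_0 mult_cancel_left1 norm_zero zero_neq_one)

lemma character_cnj_mult_self: "character ch \<Longrightarrow> cnj (ch g) * ch g = 1"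
  unfolding character_def by (metis complex_norm_square mult.commute of_real_1 power_one)

lemma character_orthogonality:
  fixes ch ch' :: "'g::{ab_group_add, finite} \<Rightarrow> complex"
  assumes "character ch" and "character ch'"
  shows "(\<Sum>g\<in>UNIV. cnj (ch g) * ch' g) = (if ch = ch' then of_nat CARD('g) else 0)"
proof (cases "ch = ch'")
  case True
  then show ?thesis
    using assms(1) by (simp add: character_cnj_mult_self)
next
  case False
  define ratio where "ratio g = cnj (ch g) * ch' g" for g
  obtain h where "ch h \<noteq> ch' h"
    using False by blast
  then have "ratio h \<noteq> 1"
    using character_cnj_mult_self[OF assms(1), of h] unfolding ratio_def
    by (metis mult.left_commute mult.right_neutral)
  have "ratio (h + g) = ratio h * ratio g" for g
    using assms unfolding character_def ratio_def by (simp add: mult_ac)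
  then have "(\<Sum>g\<in>UNIV. ratio g) = ratio h * (\<Sum>g\<in>UNIV. ratio g)"
    using sum.reindex_bij_betw[OF bij_plus[of h], of ratio] by (simp add: sum_distrib_left)
  then show ?thesis
    using False \<open>ratio h \<noteq> 1\<close> by (simp add: ratio_def)
qed

definition phase :: "real^'n \<Rightarrow> int^'n \<Rightarrow> complex" where
  "phase k d = exp (2 * of_real pi * \<i> * of_real (k \<bullet> rvec d))"

lemma norm_phase [simp]: "norm (phase k d) = 1"
  by (simp add: phase_def norm_exp_eq_Re)

lemma B_chi_eq_phase: "B_chi W ch k d d' = phase k d * ch (W d' d)"
  by (simp add: B_chi_def phase_def)

lemma fourier_matrix_eq_phase:
  "fourier_matrix D W k (g, e) (g', e') = (if e \<in> D \<and> g = g' + W e' e then phase k e else 0)"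
proof -
  have "{x \<in> D. subst W (g', e') x = (g, e)} = (if e \<in> D \<and> g = g' + W e' e then {e} else {})"
    by (auto simp: subst_def)
  then show ?thesis
    by (simp add: fourier_matrix_def phase_def)
qed

definition character_basis :: "'g::finite \<times> 'i \<Rightarrow> ('g \<Rightarrow> complex) \<times> 'i \<Rightarrow> complex" where
  "character_basis p q =
     (if snd p = snd q then fst q (fst p) / complex_of_real (sqrt CARD('g)) else 0)"

lemma sum_alphabet:
  "finite D \<Longrightarrow> (\<Sum>p\<in>alphabet D. f p) = (\<Sum>g\<in>(UNIV::'g::finite set). \<Sum>e\<in>D. f (g, e))"
  unfolding alphabet_def by (simp add: sum.cartesian_product)

lemma sqrt_card_mult_self: "complex_of_real (sqrt CARD('g::finite)) * complex_of_real (sqrt CARD('g)) = of_nat CARD('g)"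
  by (simp flip: of_real_mult)

lemma adj_character_basis_mmul:
  fixes M :: "'g::finite \<times> (int^'n) \<Rightarrow> 'j \<Rightarrow> complex"
  assumes "finite D" and "d \<in> D"
  shows "mmul (alphabet D) (adj character_basis) M (ch, d) y
           = (\<Sum>g\<in>UNIV. cnj (ch g) * M (g, d) y) / complex_of_real (sqrt CARD('g))"
proof -
  have "mmul (alphabet D) (adj character_basis) M (ch, d) y
          = (\<Sum>g\<in>UNIV. \<Sum>e\<in>D. if e = d then cnj (ch g) * M (g, e) y / complex_of_real (sqrt CARD('g)) else 0)"
    unfolding mmul_def sum_alphabet[OF assms(1)]
    by (intro sum.cong refl) (auto simp: adj_def character_basis_def)
  then show ?thesis
    using assms by (simp add: sum.delta' sum_divide_distrib)
qed

lemma mmul_character_basis: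
  fixes M :: "'j \<Rightarrow> 'g::finite \<times> (int^'n) \<Rightarrow> complex"
  assumes "finite D" and "d \<in> D"
  shows "mmul (alphabet D) M character_basis x (ch, d)
           = (\<Sum>g\<in>UNIV. M x (g, d) * ch g) / complex_of_real (sqrt CARD('g))"
proof -
  have "mmul (alphabet D) M character_basis x (ch, d)
          = (\<Sum>g\<in>UNIV. \<Sum>e\<in>D. if e = d then M x (g, e) * ch g / complex_of_real (sqrt CARD('g)) else 0)"
    unfolding mmul_def sum_alphabet[OF assms(1)]
    by (intro sum.cong refl) (auto simp: character_basis_def)
  then show ?thesis
    using assms by (simp add: sum.delta' sum_divide_distrib)
qed

lemma adj_character_basis_orthonormal:
  fixes ch ch' :: "'g::{ab_group_add, finite} \<Rightarrow> complex"
  assumes "finite D" and "(ch, d) \<in> dual_group \<times> D" and "(ch', d') \<in> dual_group \<times> D"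
  shows "mmul (alphabet D) (adj character_basis) character_basis (ch, d) (ch', d') = idm (ch, d) (ch', d')"
proof -
  have "mmul (alphabet D) (adj character_basis) character_basis (ch, d) (ch', d')
          = (if d = d' then (\<Sum>g\<in>UNIV. cnj (ch g) * ch' g) / of_nat CARD('g) else 0)"
    using assms by (simp add: adj_character_basis_mmul character_basis_def sqrt_card_mult_self
        flip: sum_divide_distrib)
  then show ?thesis
    using assms by (simp add: character_orthogonality dual_group_def idm_def)
qed

lemma character_basis_orthonormal_rows:
  fixes g g' :: "'g::{ab_group_add, finite}"
  assumes "finite D" and "finite (dual_group :: ('g \<Rightarrow> complex) set)"
    and dual_orthogonality: "\<And>g g'::'g. (\<Sum>ch\<in>dual_group. ch g * cnj (ch g'))
                                       = (if g = g' then of_nat CARD('g) else 0)"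
    and "(g, e) \<in> alphabet D" and "(g', e') \<in> alphabet D"
  shows "mmul (dual_group \<times> D) character_basis (adj character_basis) (g, e) (g', e') = idm (g, e) (g', e')"
proof -
  have "mmul (dual_group \<times> D) character_basis (adj character_basis) (g, e) (g', e')
          = (\<Sum>ch\<in>dual_group. \<Sum>d\<in>D. if d = e then (if e = e' then ch g * cnj (ch g') / of_nat CARD('g) else 0) else 0)"
    unfolding mmul_def sum.cartesian_product
    by (intro sum.cong refl) (auto simp: adj_def character_basis_def sqrt_card_mult_self)
  also have "\<dots> = (if e = e' then (\<Sum>ch\<in>dual_group. ch g * cnj (ch g')) / of_nat CARD('g) else 0)"
    using assms(1,4) by (simp add: sum.delta' alphabet_def sum_divide_distrib)
  finally show ?thesis
    by (simp add: dual_orthogonality idm_def)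
qed

lemma character_conjugates_fourier_matrix:
  fixes W :: "int^'n \<Rightarrow> int^'n \<Rightarrow> 'g::{ab_group_add, finite}"
  assumes "finite D" and "x \<in> dual_group \<times> D" and "y \<in> dual_group \<times> D"
  shows "mmul (alphabet D) (adj character_basis) (mmul (alphabet D) (fourier_matrix D W k) character_basis) x y
           = block_diag (\<lambda>ch. B_chi W (\<lambda>g. ch (- g)) k) x y"
proof -
  obtain ch d ch' d' where xy: "x = (ch, d)" "y = (ch', d')" "d \<in> D" "d' \<in> D"
    and "character ch" "character ch'"
    using assms(2,3) by (auto simp: dual_group_def)
  define w where "w = W d' d"
  define s where "s = complex_of_real (sqrt CARD('g))"
  have column: "mmul (alphabet D) (fourier_matrix D W k) character_basis (g, d) (ch', d')
                  = phase k d * ch' (g - w) / s" for g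
  proof -
    have "(\<Sum>g'\<in>UNIV. fourier_matrix D W k (g, d) (g', d') * ch' g')
            = (\<Sum>g'\<in>UNIV. if g' = g - w then phase k d * ch' g' else 0)"
      using xy(3) by (intro sum.cong refl) (auto simp: fourier_matrix_eq_phase w_def)
    then show ?thesis
      using assms(1) xy(4) by (simp add: mmul_character_basis s_def)
  qed
  have "ch' (g - w) = ch' g * ch' (- w)" for g
    using \<open>character ch'\<close> unfolding character_def by (metis diff_conv_add_uminus)
  then have "mmul (alphabet D) (adj character_basis) (mmul (alphabet D) (fourier_matrix D W k) character_basis) x y
               = phase k d * ch' (- w) * (\<Sum>g\<in>UNIV. cnj (ch g) * ch' g) / (s * s)"
    using assms(1) xy(3)
    by (simp add: xy(1,2) adj_character_basis_mmul column s_def sum_distrib_left sum_divide_distrib mult_ac)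
  also have "\<dots> = block_diag (\<lambda>ch. B_chi W (\<lambda>g. ch (- g)) k) x y"
    using \<open>character ch\<close> \<open>character ch'\<close>
    by (simp add: character_orthogonality s_def sqrt_card_mult_self block_diag_def B_chi_eq_phase xy(1,2) w_def)
  finally show ?thesis .
qed

lemma card_2_UNIV_eq:
  assumes "CARD('g) = 2"
  obtains a :: "'g::{zero, finite}" where "a \<noteq> 0" and "UNIV = {0, a}"
proof -
  obtain x y :: 'g where xy: "UNIV = {x, y}" "x \<noteq> y"
    using assms card_2_iff by metis
  have "(0::'g) \<in> {x, y}"
    unfolding xy(1)[symmetric] by simp
  then consider "x = 0" | "y = 0"
    by blast
  then show ?thesis
    using that xy by cases (auto simp: insert_commute)
qed

lemma card_2_uminus:
  fixes g :: "'g::{ab_group_add, finite}"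
  assumes "CARD('g) = 2"
  shows "- g = g"
proof -
  obtain a :: 'g where "a \<noteq> 0" "UNIV = {0, a}"
    using card_2_UNIV_eq[OF assms] .
  then have "a + a \<in> {0, a}" and "a + a \<noteq> a"
    by auto
  then have "- a = a"
    by (simp add: add_eq_0_iff)
  then show ?thesis
    using \<open>UNIV = {0, a}\<close> by (cases "g = 0") auto
qed

definition sign_character :: "'g::zero \<Rightarrow> complex" where
  "sign_character g = (if g = 0 then 1 else -1)"

lemma dual_group_card_2:
  assumes "CARD('g::{ab_group_add, finite}) = 2"
  shows "(dual_group :: ('g \<Rightarrow> complex) set) = {\<lambda>_. 1, sign_character}"
proof -
  obtain a :: 'g where "a \<noteq> 0" "UNIV = {0, a}"
    using card_2_UNIV_eq[OF assms] .
  then have elem_cases: "g = 0 \<or> g = a" for g :: 'g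
    by blast
  have "a + a = 0"
    using card_2_uminus[OF assms, of a] by (simp add: add_eq_0_iff)
  have "character (sign_character :: 'g \<Rightarrow> complex)"
    using elem_cases \<open>a \<noteq> 0\<close> \<open>a + a = 0\<close> unfolding character_def sign_character_def
    by auto
  moreover have "ch = (\<lambda>_. 1) \<or> ch = sign_character" if "character ch" for ch :: "'g \<Rightarrow> complex"
  proof -
    have "ch (a + a) = ch a * ch a"
      using that unfolding character_def by blast
    then have "ch a * ch a = 1"
      using \<open>a + a = 0\<close> character_zero[OF that] by simp
    then have "ch a = 1 \<or> ch a = -1"
      using power2_eq_1_iff[of "ch a"] by (simp add: power2_eq_square)
    then show ?thesis
    proof
      assume "ch a = 1"
      then have "ch g = 1" for g
        using elem_cases[of g] character_zero[OF that] by auto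
      then show ?thesis
        by auto
    next
      assume "ch a = -1"
      then have "ch g = sign_character g" for g
        using elem_cases[of g] character_zero[OF that] \<open>a \<noteq> 0\<close> by (auto simp: sign_character_def)
      then show ?thesis
        by auto
    qed
  qed
  ultimately show ?thesis
    by (auto simp: dual_group_def character_def)
qed

lemma dual_orthogonality_card_2:
  fixes g g' :: "'g::{ab_group_add, finite}"
  assumes "CARD('g) = 2"
  shows "(\<Sum>ch\<in>dual_group. ch g * cnj (ch g')) = (if g = g' then of_nat CARD('g) else (0::complex))"
proof -
  obtain a :: 'g where "a \<noteq> 0" "UNIV = {0, a}"
    using card_2_UNIV_eq[OF assms] .
  moreover have "(\<lambda>_. 1) \<noteq> (sign_character :: 'g \<Rightarrow> complex)"
    using \<open>a \<noteq> 0\<close> by (auto simp: fun_eq_iff sign_character_def)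
  ultimately have "(\<Sum>ch\<in>dual_group. ch g * cnj (ch g')) = 1 + sign_character g * cnj (sign_character g')"
    by (simp add: dual_group_card_2[OF assms])
  then show ?thesis
    using assms \<open>UNIV = {0, a}\<close> by (auto simp: sign_character_def)
qed

lemma unitary_on_character_basis:
  assumes "finite D" and "finite (dual_group :: ('g::{ab_group_add, finite} \<Rightarrow> complex) set)"
    and "\<And>g g'::'g. (\<Sum>ch\<in>dual_group. ch g * cnj (ch g'))
                     = (if g = g' then of_nat CARD('g) else 0)"
  shows "unitary_on (alphabet D) (dual_group \<times> D) (character_basis :: 'g \<times> (int^'n) \<Rightarrow> _)"
  unfolding unitary_on_def
proof (intro conjI ballI)
  fix x y :: "('g \<Rightarrow> complex) \<times> (int^'n)"
  assume "x \<in> dual_group \<times> D" "y \<in> dual_group \<times> D"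
  then show "mmul (alphabet D) (adj character_basis) character_basis x y = idm x y"
    using adj_character_basis_orthonormal[OF assms(1)] by (metis prod.collapse)
next
  fix x y :: "'g \<times> (int^'n)"
  assume "x \<in> alphabet D" "y \<in> alphabet D"
  then show "mmul (dual_group \<times> D) character_basis (adj character_basis) x y = idm x y"
    using character_basis_orthonormal_rows[OF assms] by (metis prod.collapse)
qed (use assms in \<open>simp_all add: alphabet_def\<close>)

theorem card_2_fourier_matrix_block_diagonal:
  fixes W :: "int^'n \<Rightarrow> int^'n \<Rightarrow> 'g::{ab_group_add, finite}"
  assumes "CARD('g) = 2" and "finite D"
  shows "unitary_on (alphabet D) (dual_group \<times> D) (character_basis :: 'g \<times> (int^'n) \<Rightarrow> _)"
    and "x \<in> dual_group \<times> D \<Longrightarrow> y \<in> dual_group \<times> D \<Longrightarrow>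
           mmul (alphabet D) (adj character_basis) (mmul (alphabet D) (fourier_matrix D W k) character_basis) x y
             = block_diag (\<lambda>ch. B_chi W ch k) x y"
proof -
  show "unitary_on (alphabet D) (dual_group \<times> D) (character_basis :: 'g \<times> (int^'n) \<Rightarrow> _)"
    using assms by (intro unitary_on_character_basis dual_orthogonality_card_2) (simp_all add: dual_group_card_2)
  show "mmul (alphabet D) (adj character_basis) (mmul (alphabet D) (fourier_matrix D W k) character_basis) x y
          = block_diag (\<lambda>ch. B_chi W ch k) x y"
    if "x \<in> dual_group \<times> D" "y \<in> dual_group \<times> D"
    using character_conjugates_fourier_matrix[OF assms(2) that] by (simp add: card_2_uminus[OF assms(1)])
qed

section \<open>Lyapunov exponents of scaled unitary cocycles\<close>

definition norm_preserving :: "'i set \<Rightarrow> ('i \<Rightarrow> 'i \<Rightarrow> complex) \<Rightarrow> bool" where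
  "norm_preserving I M \<longleftrightarrow>
     (\<forall>v. (\<Sum>i\<in>I. (cmod (\<Sum>j\<in>I. M i j * v j))\<^sup>2) = (\<Sum>j\<in>I. (cmod (v j))\<^sup>2))"

lemma unitary_on_imp_norm_preserving:
  assumes "unitary_on I I U"
  shows "norm_preserving I U"
  unfolding norm_preserving_def
proof
  fix v :: "'a \<Rightarrow> complex"
  have "finite I"
    using assms by (simp add: unitary_on_def)
  have orth: "(\<Sum>i\<in>I. cnj (U i l) * U i j) = idm l j" if "l \<in> I" "j \<in> I" for l j
    using assms that by (auto simp: unitary_on_def mmul_def adj_def)
  have "complex_of_real (\<Sum>i\<in>I. (cmod (\<Sum>j\<in>I. U i j * v j))\<^sup>2)
          = (\<Sum>i\<in>I. (\<Sum>j\<in>I. U i j * v j) * cnj (\<Sum>l\<in>I. U i l * v l))"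
    by (simp only: of_real_sum complex_norm_square)
  also have "\<dots> = (\<Sum>i\<in>I. \<Sum>l\<in>I. \<Sum>j\<in>I. (v j * cnj (v l)) * (cnj (U i l) * U i j))"
    by (simp add: sum_distrib_left sum_distrib_right mult_ac)
  also have "\<dots> = (\<Sum>l\<in>I. \<Sum>i\<in>I. \<Sum>j\<in>I. (v j * cnj (v l)) * (cnj (U i l) * U i j))"
    by (rule sum.swap)
  also have "\<dots> = (\<Sum>l\<in>I. \<Sum>j\<in>I. \<Sum>i\<in>I. (v j * cnj (v l)) * (cnj (U i l) * U i j))"
    by (intro sum.cong refl sum.swap)
  also have "\<dots> = (\<Sum>l\<in>I. \<Sum>j\<in>I. (v j * cnj (v l)) * idm l j)"
    by (intro sum.cong refl) (simp add: orth flip: sum_distrib_left)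
  also have "\<dots> = (\<Sum>l\<in>I. v l * cnj (v l))"
    using \<open>finite I\<close> by (simp add: idm_def if_distrib sum.delta cong: if_cong)
  also have "\<dots> = complex_of_real (\<Sum>j\<in>I. (cmod (v j))\<^sup>2)"
    by (simp only: of_real_sum complex_norm_square)
  finally show "(\<Sum>i\<in>I. (cmod (\<Sum>j\<in>I. U i j * v j))\<^sup>2) = (\<Sum>j\<in>I. (cmod (v j))\<^sup>2)"
    using of_real_eq_iff by blast
qed

lemma norm_preserving_idm:
  assumes "finite I"
  shows "norm_preserving I idm"
proof -
  have "(\<Sum>j\<in>I. idm i j * v j) = v i" if "i \<in> I" for i and v :: "'a \<Rightarrow> complex"
  proof -
    have "(\<Sum>j\<in>I. idm i j * v j) = (\<Sum>j\<in>I. if i = j then v j else 0)"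
      by (intro sum.cong) (auto simp: idm_def)
    then show ?thesis
      using assms that by simp
  qed
  then show ?thesis
    by (simp add: norm_preserving_def)
qed

lemma norm_preserving_mmul:
  assumes "norm_preserving I A" and "norm_preserving I B"
  shows "norm_preserving I (mmul I A B)"
  unfolding norm_preserving_def
proof
  fix v :: "'a \<Rightarrow> complex"
  define w where "w e = (\<Sum>j\<in>I. B e j * v j)" for e
  have "(\<Sum>j\<in>I. mmul I A B i j * v j) = (\<Sum>e\<in>I. A i e * w e)" for i
    unfolding mmul_def w_def sum_distrib_left sum_distrib_right
    by (subst sum.swap) (simp add: mult.assoc)
  then have "(\<Sum>i\<in>I. (cmod (\<Sum>j\<in>I. mmul I A B i j * v j))\<^sup>2) = (\<Sum>e\<in>I. (cmod (w e))\<^sup>2)"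
    using assms(1) unfolding norm_preserving_def by presburger
  also have "\<dots> = (\<Sum>j\<in>I. (cmod (v j))\<^sup>2)"
    using assms(2) unfolding norm_preserving_def w_def by blast
  finally show "(\<Sum>i\<in>I. (cmod (\<Sum>j\<in>I. mmul I A B i j * v j))\<^sup>2) = (\<Sum>j\<in>I. (cmod (v j))\<^sup>2)" .
qed

lemma cocycle_scaled_norm_preserving:
  assumes "finite I"
    and A: "\<And>k. \<exists>U. norm_preserving I U \<and> (\<forall>d\<in>I. \<forall>d'\<in>I. A k d d' = complex_of_real c * U d d')"
  shows "\<exists>M. norm_preserving I M \<and>
           (\<forall>d\<in>I. \<forall>d'\<in>I. cocycle A T I n k d d' = complex_of_real (c ^ n) * M d d')"
proof (induction n arbitrary: k)
  case 0
  show ?case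
    using norm_preserving_idm[OF \<open>finite I\<close>] by auto
next
  case (Suc n)
  obtain M where M: "norm_preserving I M"
    "\<forall>d\<in>I. \<forall>d'\<in>I. cocycle A T I n (T *v k) d d' = complex_of_real (c ^ n) * M d d'"
    using Suc.IH by blast
  obtain U where U: "norm_preserving I U" "\<forall>d\<in>I. \<forall>d'\<in>I. A k d d' = complex_of_real c * U d d'"
    using A by blast
  have "cocycle A T I (Suc n) k d d' = complex_of_real (c ^ Suc n) * mmul I U M d d'"
    if "d \<in> I" "d' \<in> I" for d d'
  proof -
    have "cocycle A T I (Suc n) k d d' = (\<Sum>e\<in>I. complex_of_real (c ^ Suc n) * (U d e * M e d'))"
      using U(2) M(2) that by (simp add: mmul_def mult_ac)
    then show ?thesis
      by (simp add: mmul_def sum_distrib_left)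
  qed
  then show ?case
    using norm_preserving_mmul[OF U(1) M(1)] by blast
qed

lemma opnorm_scaled_norm_preserving:
  assumes "finite I" and "I \<noteq> {}" and "norm_preserving I M" and "r \<ge> 0"
    and C: "\<forall>i\<in>I. \<forall>j\<in>I. C i j = complex_of_real r * M i j"
  shows "opnorm I C = r"
proof -
  have scaled_norm: "sqrt (\<Sum>i\<in>I. (cmod (\<Sum>j\<in>I. C i j * v j))\<^sup>2) = r * sqrt (\<Sum>j\<in>I. (cmod (v j))\<^sup>2)" for v
  proof -
    have "(\<Sum>j\<in>I. C i j * v j) = complex_of_real r * (\<Sum>j\<in>I. M i j * v j)" if "i \<in> I" for i
      using C that by (simp add: sum_distrib_left mult_ac)
    then have "(cmod (\<Sum>j\<in>I. C i j * v j))\<^sup>2 = r\<^sup>2 * (cmod (\<Sum>j\<in>I. M i j * v j))\<^sup>2" if "i \<in> I" for i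
      using \<open>r \<ge> 0\<close> that by (simp add: norm_mult power_mult_distrib)
    then have "(\<Sum>i\<in>I. (cmod (\<Sum>j\<in>I. C i j * v j))\<^sup>2) = r\<^sup>2 * (\<Sum>i\<in>I. (cmod (\<Sum>j\<in>I. M i j * v j))\<^sup>2)"
      by (simp add: sum_distrib_left)
    also have "\<dots> = r\<^sup>2 * (\<Sum>j\<in>I. (cmod (v j))\<^sup>2)"
      using \<open>norm_preserving I M\<close> unfolding norm_preserving_def by simp
    finally show ?thesis
      using \<open>r \<ge> 0\<close> by (simp add: real_sqrt_mult)
  qed
  let ?S = "{sqrt (\<Sum>i\<in>I. (cmod (\<Sum>j\<in>I. C i j * v j))\<^sup>2) | v. (\<Sum>j\<in>I. (cmod (v j))\<^sup>2) \<le> 1}"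
  obtain i0 where "i0 \<in> I"
    using \<open>I \<noteq> {}\<close> by blast
  define e :: "_ \<Rightarrow> complex" where "e j = (if j = i0 then 1 else 0)" for j
  have "(\<Sum>j\<in>I. (cmod (e j))\<^sup>2) = (\<Sum>j\<in>I. if j = i0 then 1 else 0)"
    by (intro sum.cong) (auto simp: e_def)
  then have "(\<Sum>j\<in>I. (cmod (e j))\<^sup>2) = 1"
    using \<open>finite I\<close> \<open>i0 \<in> I\<close> by simp
  then have "r \<in> ?S"
    using scaled_norm[of e] by force
  moreover have "x \<le> r" if x: "x \<in> ?S" for x
  proof -
    obtain v where "x = sqrt (\<Sum>i\<in>I. (cmod (\<Sum>j\<in>I. C i j * v j))\<^sup>2)" "(\<Sum>j\<in>I. (cmod (v j))\<^sup>2) \<le> 1"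
      using x by blast
    then show ?thesis
      using scaled_norm[of v] \<open>r \<ge> 0\<close> by (simp add: mult_left_le)
  qed
  ultimately show ?thesis
    unfolding opnorm_def by (intro cSup_eq_maximum)
qed

theorem lyapunov_scaled_norm_preserving:
  assumes "finite I" and "I \<noteq> {}" and "c > 0"
    and "\<And>k. \<exists>U. norm_preserving I U \<and> (\<forall>d\<in>I. \<forall>d'\<in>I. A k d d' = complex_of_real c * U d d')"
  shows "lyapunov A T I k = ereal (ln c)"
proof -
  have "ln (opnorm I (cocycle A T I n k)) / real n = ln c" if "n > 0" for n
  proof -
    obtain M where "norm_preserving I M"
      "\<forall>d\<in>I. \<forall>d'\<in>I. cocycle A T I n k d d' = complex_of_real (c ^ n) * M d d'"
      using cocycle_scaled_norm_preserving[of I A c T n k] assms(1,4) by blast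
    then have "opnorm I (cocycle A T I n k) = c ^ n"
      using opnorm_scaled_norm_preserving[OF assms(1,2)] \<open>c > 0\<close> by simp
    then show ?thesis
      using that \<open>c > 0\<close> by (simp add: ln_realpow)
  qed
  then have "\<forall>\<^sub>F n in sequentially. ereal (ln (opnorm I (cocycle A T I n k)) / real n) = ereal (ln c)"
    by (intro eventually_sequentiallyI[of 1]) simp
  then have "(\<lambda>n. ereal (ln (opnorm I (cocycle A T I n k)) / real n)) \<longlonglongrightarrow> ereal (ln c)"
    by (rule tendsto_eventually)
  then show ?thesis
    unfolding lyapunov_def by (intro lim_imp_Limsup) simp_all
qed

lemma idm_commute: "idm i j = idm j i"
  by (simp add: idm_def eq_commute)

lemma unitary_on_phase_transpose:
  assumes "unitary_on I I M" and "\<And>i. cmod (p i) = 1"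
  shows "unitary_on I I (\<lambda>i j. p i * M j i)"
proof -
  have unit: "cnj (p i) * p i = 1" for i
    using complex_norm_square[of "p i"] assms(2)[of i] by (simp add: mult.commute)
  have cols: "(\<Sum>r\<in>I. cnj (M r i) * M r j) = idm i j"
    and rows: "(\<Sum>r\<in>I. M i r * cnj (M j r)) = idm i j" if "i \<in> I" "j \<in> I" for i j
    using assms(1) that by (auto simp: unitary_on_def mmul_def adj_def)
  show ?thesis
    unfolding unitary_on_def
  proof (intro conjI ballI)
    fix i j
    assume "i \<in> I" "j \<in> I"
    have "mmul I (adj (\<lambda>i j. p i * M j i)) (\<lambda>i j. p i * M j i) i j
            = (\<Sum>r\<in>I. (cnj (p r) * p r) * (M j r * cnj (M i r)))"
      by (simp add: mmul_def adj_def mult_ac)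
    also have "\<dots> = idm i j"
      using rows[OF \<open>j \<in> I\<close> \<open>i \<in> I\<close>] by (simp add: unit idm_commute)
    finally show "mmul I (adj (\<lambda>i j. p i * M j i)) (\<lambda>i j. p i * M j i) i j = idm i j" .
  next
    fix i j
    assume "i \<in> I" "j \<in> I"
    have "mmul I (\<lambda>i j. p i * M j i) (adj (\<lambda>i j. p i * M j i)) i j
            = p i * cnj (p j) * (\<Sum>r\<in>I. cnj (M r j) * M r i)"
      by (simp add: mmul_def adj_def sum_distrib_left mult_ac)
    also have "\<dots> = idm i j"
      using cols[OF \<open>j \<in> I\<close> \<open>i \<in> I\<close>] unit[of i] by (auto simp: idm_def mult.commute)
    finally show "mmul I (\<lambda>i j. p i * M j i) (adj (\<lambda>i j. p i * M j i)) i j = idm i j" .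
  qed (use assms(1) in \<open>simp_all add: unitary_on_def\<close>)
qed

lemma chi_unitary_imp_B_chi_scaled_unitary:
  assumes "chi_unitary D W ch"
  shows "\<exists>U. unitary_on D D U \<and>
           (\<forall>d\<in>D. \<forall>d'\<in>D. B_chi W ch k d d' = complex_of_real (sqrt (card D)) * U d d')"
proof -
  define M where "M = (\<lambda>d d'. ch (W d d') / complex_of_real (sqrt (card D)))"
  have "unitary_on D D M"
    using assms by (simp add: chi_unitary_def M_def)
  then have "finite D"
    by (simp add: unitary_on_def)
  have "B_chi W ch k d d' = complex_of_real (sqrt (card D)) * (phase k d * M d' d)" if "d \<in> D" for d d'
  proof -
    have "complex_of_real (sqrt (card D)) \<noteq> 0"
      using \<open>finite D\<close> that card_gt_0_iff by force
    then show ?thesis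
      by (simp add: B_chi_eq_phase M_def)
  qed
  with unitary_on_phase_transpose[OF \<open>unitary_on D D M\<close> norm_phase] show ?thesis
    by (intro exI[of _ "\<lambda>d d'. phase k d * M d' d"]) simp
qed

theorem proposition4p16:
  fixes Q :: "int^'n^'n"
    and D :: "(int^'n) set"
    and W :: "int^'n \<Rightarrow> int^'n \<Rightarrow> 'g::{ab_group_add, finite}"
  assumes expansive: "expansive Q"
    and reps: "coset_reps Q D"
    and qubit: "CARD('g) = 2"
    and prim: "primitive D W"
    and aper: "aperiodic Q D W"
  shows "(\<exists>V. unitary_on (alphabet D) (dual_group \<times> D) V \<and>
            (\<forall>k. \<forall>x\<in>dual_group \<times> D. \<forall>y\<in>dual_group \<times> D.
               mmul (alphabet D) (adj V) (mmul (alphabet D) (fourier_matrix D W k) V) x y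
                 = block_diag (\<lambda>ch. B_chi W ch k) x y))
       \<and> (\<forall>ch\<in>dual_group. chi_unitary D W ch \<longrightarrow>
            (\<forall>k. \<exists>U. unitary_on D D U \<and>
               (\<forall>d\<in>D. \<forall>d'\<in>D. B_chi W ch k d d' = of_real (sqrt \<bar>det (rmat Q)\<bar>) * U d d'))
          \<and> (\<forall>k. lyapunov (B_chi W ch) (transpose (rmat Q)) D k = ereal (ln (sqrt \<bar>det (rmat Q)\<bar>))))"
proof -
  have "D \<noteq> {}"
    using reps by (rule coset_reps_nonempty)
  then have "finite D"
    using prim primitive_imp_finite by blast
  have sqrt_det: "sqrt \<bar>det (rmat Q)\<bar> = sqrt (card D)"
    using card_coset_reps_eq_abs_det[OF reps \<open>finite D\<close> expansive_det_nonzero[OF expansive]] by simp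
  have "sqrt (card D) > 0"
    using \<open>finite D\<close> \<open>D \<noteq> {}\<close> by (simp add: card_gt_0_iff)
  show ?thesis
    unfolding sqrt_det
  proof (intro conjI ballI impI allI)
    fix ch :: "'g \<Rightarrow> complex" and k
    assume "chi_unitary D W ch"
    then show "\<exists>U. unitary_on D D U \<and>
                 (\<forall>d\<in>D. \<forall>d'\<in>D. B_chi W ch k d d' = complex_of_real (sqrt (card D)) * U d d')"
      by (rule chi_unitary_imp_B_chi_scaled_unitary)
    show "lyapunov (B_chi W ch) (transpose (rmat Q)) D k = ereal (ln (sqrt (card D)))"
      using \<open>finite D\<close> \<open>D \<noteq> {}\<close> \<open>sqrt (card D) > 0\<close>
        chi_unitary_imp_B_chi_scaled_unitary[OF \<open>chi_unitary D W ch\<close>] unitary_on_imp_norm_preserving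
      by (intro lyapunov_scaled_norm_preserving) blast+
  qed (use card_2_fourier_matrix_block_diagonal[OF qubit \<open>finite D\<close>] in blast)
qed

end
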